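(* Let ${\bf u},{\bf B},{\bf A}$ be smooth time-dependent vector fields on $\mathbb R^3$ and $\varphi,\psi$ smooth functions on $\mathbb R\times\mathbb R^3$ such that $${\bf B}=\nabla\times{\bf A},\qquad \frac{\partial {\bf B}}{\partial t}-\nabla\times({\bf u}\times{\bf B})=0,\qquad \frac{\partial\varphi}{\partial t}+{\bf u}\cdot\nabla\varphi=0,\qquad \frac{\partial{\bf A}}{\partial t}-{\bf u}\times(\nabla\times{\bf A})=\nabla(\varphi+\psi).$$ Put $${\bf E}=-(\nabla\varphi+{\bf u}\times{\bf B}),\qquad q=\nabla\cdot{\bf E},\qquad {\bf J}=-\frac{\partial{\bf E}}{\partial t}+\nabla\times{\bf B},$$ $$\Theta_E=q\,dx\wedge dy\wedge dz-{\bf J}\cdot(d{\bf x}\wedge d{\bf x})\wedge dt .$$ Then $\Theta_E$ is an absolute invariant of $\partial_t+u$, $u={\bf u}\cdot\nabla$, if and only if $q{\bf u}-{\bf J}$ is divergence-free and is a time-dependent symmetry of ${\bf u}$. In this case: (1) if ${\bf u}$ is divergence-free, $q$ is also a Lagrangian invariant, i.e. $\frac{\partial q}{\partial t}+{\bf u}\cdot\nabla q=0$; (2) ${\bf A}\cdot(q{\bf u}-{\bf J})$ is an Eulerian conserved density (depending on the dynamics of the velocity field, i.e. on $\partial{\bf u}/\partial t$, through the definition of ${\bf J}$).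
   Context: Coordinates on $\mathbb R\times\mathbb R^3$ are $(t,{\bf x})=(t,x,y,z)$; $\nabla$, $\nabla\cdot$, $\nabla\times$ act on the spatial variables only, and ${\bf V}\cdot(d{\bf x}\wedge d{\bf x})=V_1\,dy\wedge dz+V_2\,dz\wedge dx+V_3\,dx\wedge dy$ for ${\bf V}=(V_1,V_2,V_3)$. A differential form $\Theta$ on $\mathbb R\times\mathbb R^3$ is an absolute invariant of $\partial_t+u$ if its Lie derivative vanishes, $\mathcal L_{\partial_t+u}\Theta=0$. A time-dependent vector field ${\bf v}$, with $v={\bf v}\cdot\nabla$, is a time-dependent symmetry of ${\bf u}$ if $\frac{\partial v}{\partial t}+[u,v]=-(\nabla\cdot{\bf u})\,v$, where $[\cdot,\cdot]$ is the Lie bracket (commutator) of the spatial vector fields at fixed $t$; the right-hand side vanishes for divergence-free ${\bf u}$. A function $T$ is an Eulerian conserved density if there is a flux ${\bf P}$ with $\frac{\partial T}{\partial t}+\nabla\cdot{\bf P}=0$, where $T$ and ${\bf P}$ are given by expressions (functions) in $t$, ${\bf x}$, the Eulerian fields (here ${\bf u},{\bf A},{\bf B},\varphi,\psi$) and their derivatives. *)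

theory Defs
  imports "HOL-Analysis.Analysis"
begin

unbundle cross3_syntax

section \<open>Smooth maps and vector calculus\<close>

primrec C_k :: "nat \<Rightarrow> ('a::real_normed_vector \<Rightarrow> 'b::real_normed_vector) \<Rightarrow> bool" where
  "C_k 0 f \<longleftrightarrow> continuous_on UNIV f"
| "C_k (Suc n) f \<longleftrightarrow>
     (\<forall>x. f differentiable (at x)) \<and> (\<forall>v. C_k n (\<lambda>x. frechet_derivative f (at x) v))"

definition smooth :: "('a::real_normed_vector \<Rightarrow> 'b::real_normed_vector) \<Rightarrow> bool" where
  "smooth f \<longleftrightarrow> (\<forall>n. C_k n f)"

definition time_deriv ::
  "(real \<Rightarrow> real^3 \<Rightarrow> 'b::real_normed_vector) \<Rightarrow> real \<Rightarrow> real^3 \<Rightarrow> 'b" where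
  "time_deriv F t x = vector_derivative (\<lambda>s. F s x) (at t)"

definition partial :: "3 \<Rightarrow> (real^3 \<Rightarrow> 'b::real_normed_vector) \<Rightarrow> real^3 \<Rightarrow> 'b" where
  "partial i F x = frechet_derivative F (at x) (axis i 1)"

definition grad :: "(real^3 \<Rightarrow> real) \<Rightarrow> real^3 \<Rightarrow> real^3" where
  "grad F x = (\<chi> i. partial i F x)"

definition divergence :: "(real^3 \<Rightarrow> real^3) \<Rightarrow> real^3 \<Rightarrow> real" where
  "divergence F x = (\<Sum>i\<in>UNIV. partial i (\<lambda>y. F y $ i) x)"

definition curl :: "(real^3 \<Rightarrow> real^3) \<Rightarrow> real^3 \<Rightarrow> real^3" where
  "curl F x = vector
     [partial 2 (\<lambda>y. F y $ 3) x - partial 3 (\<lambda>y. F y $ 2) x,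
      partial 3 (\<lambda>y. F y $ 1) x - partial 1 (\<lambda>y. F y $ 3) x,
      partial 1 (\<lambda>y. F y $ 2) x - partial 2 (\<lambda>y. F y $ 1) x]"

text \<open>The commutator of X and Y as derivations, \<open>[X,Y] = XY - YX\<close>.\<close>

definition lie_bracket ::
  "('a::real_normed_vector \<Rightarrow> 'a) \<Rightarrow> ('a \<Rightarrow> 'a) \<Rightarrow> 'a \<Rightarrow> 'a" where
  "lie_bracket X Y p = frechet_derivative Y (at p) (X p) - frechet_derivative X (at p) (Y p)"


section \<open>Differential forms\<close>

text \<open>A k-form assigns to a point an alternating k-linear function of the tangent vectors
  \<open>v 0, \<dots>, v (k - 1)\<close>; the entries of v from index k on are ignored.\<close>

type_synonym 'a form = "'a \<Rightarrow> (nat \<Rightarrow> 'a) \<Rightarrow> real"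

definition wedge :: "nat \<Rightarrow> nat \<Rightarrow> 'a form \<Rightarrow> 'a form \<Rightarrow> 'a form" where
  "wedge k l \<alpha> \<beta> p v =
     (\<Sum>\<sigma> | \<sigma> permutes {..<k + l}.
        of_int (sign \<sigma>) * \<alpha> p (\<lambda>i. v (\<sigma> i)) * \<beta> p (\<lambda>i. v (\<sigma> (k + i)))) / (fact k * fact l)"

text \<open>The formula
  \<open>(L_X \<omega>)(Y_1,\<dots>,Y_k) = X(\<omega>(Y_1,\<dots>,Y_k)) - \<Sum>i. \<omega>(Y_1,\<dots>,[X,Y_i],\<dots>,Y_k)\<close>, which is tensorial in
  the \<open>Y_i\<close>, evaluated on the constant vector fields with values \<open>v i\<close>.\<close>

definition lie_derivative ::
  "nat \<Rightarrow> ('a::real_normed_vector \<Rightarrow> 'a) \<Rightarrow> 'a form \<Rightarrow> 'a form" where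
  "lie_derivative k X \<omega> p v =
     frechet_derivative (\<lambda>q. \<omega> q v) (at p) (X p)
     - (\<Sum>i<k. \<omega> p (v(i := lie_bracket X (\<lambda>_. v i) p)))"

type_synonym spacetime = "real \<times> (real^3)"

definition dt :: "spacetime form" where
  "dt p v = fst (v 0)"

definition dx :: "3 \<Rightarrow> spacetime form" where
  "dx i p v = snd (v 0) $ i"

definition volume_form :: "spacetime form" where
  "volume_form = wedge 2 1 (wedge 1 1 (dx 1) (dx 2)) (dx 3)"

definition flux_form :: "(real \<Rightarrow> real^3 \<Rightarrow> real^3) \<Rightarrow> spacetime form" where
  "flux_form V p v =
     (case p of (t, x) \<Rightarrow>
        V t x $ 1 * wedge 1 1 (dx 2) (dx 3) p v
      + V t x $ 2 * wedge 1 1 (dx 3) (dx 1) p v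
      + V t x $ 3 * wedge 1 1 (dx 1) (dx 2) p v)"

definition material_field :: "(real \<Rightarrow> real^3 \<Rightarrow> real^3) \<Rightarrow> spacetime \<Rightarrow> spacetime" where
  "material_field u = (\<lambda>(t, x). (1, u t x))"

definition absolute_invariant ::
  "nat \<Rightarrow> (real \<Rightarrow> real^3 \<Rightarrow> real^3) \<Rightarrow> spacetime form \<Rightarrow> bool" where
  "absolute_invariant k u \<Theta> \<longleftrightarrow> (\<forall>p v. lie_derivative k (material_field u) \<Theta> p v = 0)"

definition divergence_free :: "(real \<Rightarrow> real^3 \<Rightarrow> real^3) \<Rightarrow> bool" where
  "divergence_free V \<longleftrightarrow> (\<forall>t x. divergence (V t) x = 0)"

definition time_dependent_symmetry ::
  "(real \<Rightarrow> real^3 \<Rightarrow> real^3) \<Rightarrow> (real \<Rightarrow> real^3 \<Rightarrow> real^3) \<Rightarrow> bool" where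
  "time_dependent_symmetry u V \<longleftrightarrow>
     (\<forall>t x. time_deriv V t x + lie_bracket (u t) (V t) x = - divergence (u t) x *\<^sub>R V t x)"

definition lagrangian_invariant ::
  "(real \<Rightarrow> real^3 \<Rightarrow> real^3) \<Rightarrow> (real \<Rightarrow> real^3 \<Rightarrow> real) \<Rightarrow> bool" where
  "lagrangian_invariant u F \<longleftrightarrow> (\<forall>t x. time_deriv F t x + u t x \<bullet> grad (F t) x = 0)"


section \<open>The fields\<close>

record eulerian_fields =
  vel :: "real \<Rightarrow> real^3 \<Rightarrow> real^3"
  pot :: "real \<Rightarrow> real^3 \<Rightarrow> real^3"
  mag :: "real \<Rightarrow> real^3 \<Rightarrow> real^3"
  phi :: "real \<Rightarrow> real^3 \<Rightarrow> real"
  psi :: "real \<Rightarrow> real^3 \<Rightarrow> real"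

definition smooth_fields :: "eulerian_fields \<Rightarrow> bool" where
  "smooth_fields f \<longleftrightarrow>
     smooth (\<lambda>(t, x). vel f t x) \<and> smooth (\<lambda>(t, x). pot f t x) \<and> smooth (\<lambda>(t, x). mag f t x) \<and>
     smooth (\<lambda>(t, x). phi f t x) \<and> smooth (\<lambda>(t, x). psi f t x)"

definition frozen_in_system :: "eulerian_fields \<Rightarrow> bool" where
  "frozen_in_system f \<longleftrightarrow>
     smooth_fields f \<and>
     (\<forall>t x. mag f t x = curl (pot f t) x) \<and>
     (\<forall>t x. time_deriv (mag f) t x - curl (\<lambda>y. vel f t y \<times> mag f t y) x = 0) \<and>
     (\<forall>t x. time_deriv (phi f) t x + vel f t x \<bullet> grad (phi f t) x = 0) \<and>
     (\<forall>t x. time_deriv (pot f) t x - vel f t x \<times> curl (pot f t) x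
              = grad (\<lambda>y. phi f t y + psi f t y) x)"

definition electric :: "eulerian_fields \<Rightarrow> real \<Rightarrow> real^3 \<Rightarrow> real^3" where
  "electric f t x = - (grad (phi f t) x + vel f t x \<times> mag f t x)"

definition charge :: "eulerian_fields \<Rightarrow> real \<Rightarrow> real^3 \<Rightarrow> real" where
  "charge f t x = divergence (electric f t) x"

definition current :: "eulerian_fields \<Rightarrow> real \<Rightarrow> real^3 \<Rightarrow> real^3" where
  "current f t x = - time_deriv (electric f) t x + curl (mag f t) x"

definition Theta_E :: "eulerian_fields \<Rightarrow> spacetime form" where
  "Theta_E f p v =
     (case p of (t, x) \<Rightarrow> charge f t x * volume_form p v)
     - wedge 2 1 (flux_form (current f)) dt p v"

text \<open>The field \<open>q u - J\<close>.\<close>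

definition relative_current :: "eulerian_fields \<Rightarrow> real \<Rightarrow> real^3 \<Rightarrow> real^3" where
  "relative_current f t x = charge f t x *\<^sub>R vel f t x - current f t x"


section \<open>Conserved densities\<close>

text \<open>Scalar expressions in t, x, the fields and finitely many of their derivatives. Such an
  expression is an operator on all field configurations, independent of any particular
  solution. Constants, sums and products are instances of the rule \<open>comp\<close>.\<close>

inductive differential_function :: "(eulerian_fields \<Rightarrow> real \<Rightarrow> real^3 \<Rightarrow> real) \<Rightarrow> bool" where
  time: "differential_function (\<lambda>f t x. t)"
| space: "differential_function (\<lambda>f t x. x $ i)"
| vel: "differential_function (\<lambda>f t x. vel f t x $ i)"
| pot: "differential_function (\<lambda>f t x. pot f t x $ i)"
| mag: "differential_function (\<lambda>f t x. mag f t x $ i)"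
| phi: "differential_function (\<lambda>f t x. phi f t x)"
| psi: "differential_function (\<lambda>f t x. psi f t x)"
| time_deriv: "differential_function e \<Longrightarrow> differential_function (\<lambda>f t x. time_deriv (e f) t x)"
| partial: "differential_function e \<Longrightarrow> differential_function (\<lambda>f t x. partial i (e f t) x)"
| comp: "differential_function e \<Longrightarrow> differential_function e' \<Longrightarrow>
    smooth (g :: real \<times> real \<Rightarrow> real) \<Longrightarrow> differential_function (\<lambda>f t x. g (e f t x, e' f t x))"

text \<open>Only the values on smooth fields matter: elsewhere the derivatives are unspecified, and the
  derivative of a vector field need not be the vector of derivatives of its components.\<close>

definition eulerian_expression :: "(eulerian_fields \<Rightarrow> real \<Rightarrow> real^3 \<Rightarrow> real) \<Rightarrow> bool" where
  "eulerian_expression T \<longleftrightarrow>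
     (\<exists>e. differential_function e \<and> (\<forall>f. smooth_fields f \<longrightarrow> T f = e f))"

text \<open>The flux has to be one expression valid on the whole solution set S. For a single solution
  the existence of a flux would be no condition, as every smooth function is the divergence of
  some vector field.\<close>

definition eulerian_conserved_density ::
  "eulerian_fields set \<Rightarrow> (eulerian_fields \<Rightarrow> real \<Rightarrow> real^3 \<Rightarrow> real) \<Rightarrow> bool" where
  "eulerian_conserved_density S T \<longleftrightarrow>
     eulerian_expression T \<and>
     (\<exists>P :: eulerian_fields \<Rightarrow> real \<Rightarrow> real^3 \<Rightarrow> real^3.
        (\<forall>i. eulerian_expression (\<lambda>f t x. P f t x $ i)) \<and>
        (\<forall>f\<in>S. \<forall>t x. time_deriv (T f) t x + divergence (P f t) x = 0))"

text \<open>Two solutions with the same fields A, B, \<open>\<phi>\<close> and, at one instant, the same u and \<open>\<psi>\<close> can have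
  different T at that instant. (\<open>\<psi>\<close> cannot be held fixed at other times, because the evolution
  equation for A ties its gradient to u.)\<close>

definition depends_on_velocity_dynamics ::
  "eulerian_fields set \<Rightarrow> (eulerian_fields \<Rightarrow> real \<Rightarrow> real^3 \<Rightarrow> real) \<Rightarrow> bool" where
  "depends_on_velocity_dynamics S T \<longleftrightarrow>
     (\<exists>f\<in>S. \<exists>g\<in>S. \<exists>t x.
        pot f = pot g \<and> mag f = mag g \<and> phi f = phi g \<and> vel f t = vel g t \<and> psi f t = psi g t \<and>
        T f t x \<noteq> T g t x)"

end

theory Submission
  imports Defs
begin

text \<open>Writing \<open>X = (1, u)\<close>, \<open>Y = (q, J)\<close> and \<open>W = q u - J\<close>, the form \<open>\<Theta>_E\<close> is the contraction of the
  volume form of spacetime with \<open>Y\<close>, so that its Lie derivative along \<open>X\<close> vanishes if and only if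
  \<open>[X, Y] + (\<nabla>\<cdot>u) Y = 0\<close>. Since \<open>Y = q X - (0, W)\<close>, this splits into the scalar equation
  \<open>X q + q \<nabla>\<cdot>u = 0\<close> and the symmetry condition for \<open>W\<close>; by charge conservation
  \<open>\<partial>q/\<partial>t + \<nabla>\<cdot>J = 0\<close>, the scalar expression is \<open>\<nabla>\<cdot>W\<close>. The density \<open>A\<cdot>W\<close> has the flux
  \<open>(A\<cdot>W) u - (\<phi> + \<psi> + u\<cdot>A) W\<close>.\<close>

section \<open>Smooth maps\<close>

text \<open>The bracket equation is L_X (i_Y vol) = i_[X,Y] vol + i_Y (L_X vol), with L_X vol = (div
  u) vol because the time component of X is constant; the equivalence follows since contraction with
  a volume form is injective. Forms are here functions of argument tuples, so this is carried out by
  evaluating on three arbitrary tangent vectors. The key ingredient is det(M a, b, c) + det(a, M b,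
  c) + det(a, b, M c) = tr M det(a, b, c) for the Jacobian M of u. The split works because (0, W) is
  tangent to the time slices, and so is its bracket with X: the scalar equation is the coefficient
  of X. Charge conservation is an identity in E and B, resting on div curl = 0 and on exchanging
  time derivative and divergence; both need symmetric second derivatives. Joint smoothness in t and
  x makes time and space derivatives values of one Frechet derivative on spacetime.\<close>

lemma C_k_Suc_D: "C_k (Suc n) f \<Longrightarrow> C_k n f"
proof (induction n arbitrary: f)
  case 0
  then show ?case
    by (auto intro!: continuous_at_imp_continuous_on differentiable_imp_continuous_within)
next
  case (Suc n)
  then show ?case
    by (metis C_k.simps(2))
qed

lemma C_k_const: "C_k n (\<lambda>x. c)"
  by (induction n arbitrary: c) auto

lemma C_k_bounded_linear:
  assumes "bounded_linear h"
  shows "C_k n f \<Longrightarrow> C_k n (\<lambda>x. h (f x))"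
proof (induction n arbitrary: f)
  case 0
  then show ?case
    using bounded_linear.continuous_on[OF assms] by simp
next
  case (Suc n)
  have d: "((\<lambda>x. h (f x)) has_derivative (\<lambda>v. h (frechet_derivative f (at x) v))) (at x)" for x
    using Suc.prems by (auto intro!: bounded_linear.has_derivative[OF assms] simp: frechet_derivative_works)
  then have "(\<lambda>x. frechet_derivative (\<lambda>x. h (f x)) (at x) v) = (\<lambda>x. h (frechet_derivative f (at x) v))" for v
    by (simp add: frechet_derivative_at[OF d, symmetric])
  with Suc d show ?case
    by (auto simp: differentiable_def)
qed

lemma C_k_add: "C_k n f \<Longrightarrow> C_k n g \<Longrightarrow> C_k n (\<lambda>x. f x + g x)"
proof (induction n arbitrary: f g)
  case 0
  then show ?case
    by (simp add: continuous_on_add)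
next
  case (Suc n)
  have d: "((\<lambda>x. f x + g x) has_derivative
      (\<lambda>v. frechet_derivative f (at x) v + frechet_derivative g (at x) v)) (at x)" for x
    using Suc.prems by (auto intro!: has_derivative_add simp: frechet_derivative_works)
  then have "(\<lambda>x. frechet_derivative (\<lambda>x. f x + g x) (at x) v)
      = (\<lambda>x. frechet_derivative f (at x) v + frechet_derivative g (at x) v)" for v
    by (simp add: frechet_derivative_at[OF d, symmetric])
  with Suc d show ?case
    by (auto simp: differentiable_def)
qed

lemma C_k_bounded_bilinear:
  assumes "bounded_bilinear h"
  shows "C_k n f \<Longrightarrow> C_k n g \<Longrightarrow> C_k n (\<lambda>x. h (f x) (g x))"
proof (induction n arbitrary: f g)
  case 0
  then show ?case
    using bounded_bilinear.continuous_on[OF assms] by simp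
next
  case (Suc n)
  have d: "((\<lambda>x. h (f x) (g x)) has_derivative
      (\<lambda>v. h (f x) (frechet_derivative g (at x) v) + h (frechet_derivative f (at x) v) (g x))) (at x)" for x
    using Suc.prems by (auto intro!: bounded_bilinear.FDERIV[OF assms] simp: frechet_derivative_works)
  then have "(\<lambda>x. frechet_derivative (\<lambda>x. h (f x) (g x)) (at x) v)
      = (\<lambda>x. h (f x) (frechet_derivative g (at x) v) + h (frechet_derivative f (at x) v) (g x))" for v
    by (simp add: frechet_derivative_at[OF d, symmetric])
  \<comment> \<open>The product rule leaves one factor undifferentiated, while the induction
    hypothesis asks for order n of both factors.\<close>
  moreover have "C_k n f" "C_k n g"
    using Suc.prems C_k_Suc_D by blast+
  ultimately show ?case
    using Suc.prems d by (auto intro!: C_k_add Suc.IH simp: differentiable_def)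
qed

lemma smooth_const: "smooth (\<lambda>x. c)"
  by (simp add: smooth_def C_k_const)

lemma smooth_add: "smooth f \<Longrightarrow> smooth g \<Longrightarrow> smooth (\<lambda>x. f x + g x)"
  by (simp add: smooth_def C_k_add)

lemma smooth_bounded_linear: "bounded_linear h \<Longrightarrow> smooth f \<Longrightarrow> smooth (\<lambda>x. h (f x))"
  by (simp add: smooth_def C_k_bounded_linear)

lemma smooth_bounded_bilinear:
  "bounded_bilinear h \<Longrightarrow> smooth f \<Longrightarrow> smooth g \<Longrightarrow> smooth (\<lambda>x. h (f x) (g x))"
  by (simp add: smooth_def C_k_bounded_bilinear)

lemma smooth_ident: "smooth (\<lambda>x. x)"
proof -
  have "C_k n (\<lambda>x::'a. x)" for n
    by (cases n) (auto simp: C_k_const)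
  then show ?thesis
    by (simp add: smooth_def)
qed

lemma smooth_linear: "bounded_linear h \<Longrightarrow> smooth h"
  using smooth_bounded_linear[OF _ smooth_ident] by blast

lemma smooth_frechet_derivative: "smooth f \<Longrightarrow> smooth (\<lambda>x. frechet_derivative f (at x) v)"
  unfolding smooth_def by (metis C_k.simps(2))

lemma smooth_imp_differentiable: "smooth f \<Longrightarrow> f differentiable (at x)"
  unfolding smooth_def by (metis C_k.simps(2))

lemma smooth_imp_has_derivative:
  "smooth f \<Longrightarrow> (f has_derivative frechet_derivative f (at x)) (at x)"
  using smooth_imp_differentiable frechet_derivative_works by blast

lemma smooth_imp_continuous: "smooth f \<Longrightarrow> continuous (at x) f"
  by (simp add: differentiable_imp_continuous_within smooth_imp_differentiable)

section \<open>Symmetry of second derivatives\<close>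

lemma smooth_has_real_derivative_line:
  assumes "smooth (f :: 'a::real_normed_vector \<Rightarrow> real)"
  shows "((\<lambda>s. f (p + s *\<^sub>R v)) has_real_derivative frechet_derivative f (at (p + s *\<^sub>R v)) v) (at s)"
proof -
  have "((\<lambda>s. p + s *\<^sub>R v) has_derivative (\<lambda>h. h *\<^sub>R v)) (at s)"
    by (auto intro!: derivative_eq_intros)
  from diff_chain_at[OF this smooth_imp_has_derivative[OF assms]]
  have "((\<lambda>s. f (p + s *\<^sub>R v)) has_derivative (\<lambda>h. frechet_derivative f (at (p + s *\<^sub>R v)) (h *\<^sub>R v))) (at s)"
    by (simp add: o_def)
  moreover have "linear (frechet_derivative f (at (p + s *\<^sub>R v)))"
    by (intro linear_frechet_derivative smooth_imp_differentiable assms)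
  ultimately show ?thesis
    by (simp add: has_field_derivative_def linear_cmul mult_commute_abs)
qed

text \<open>The mean value theorem is applied twice: along v to the difference \<open>?g\<close> of
  two translates of f, then along w to the v-derivative. The left side is symmetric in v and w, the
  right side is not; this is the source of the symmetry of mixed derivatives.\<close>

lemma smooth_second_difference:
  assumes f: "smooth (f :: 'a::real_normed_vector \<Rightarrow> real)" and h: "h > 0"
  obtains r s where "0 < r" "r < h" "0 < s" "s < h"
    "f (p + h *\<^sub>R v + h *\<^sub>R w) - f (p + h *\<^sub>R v) - f (p + h *\<^sub>R w) + f p
      = h\<^sup>2 * frechet_derivative (\<lambda>x. frechet_derivative f (at x) v) (at (p + r *\<^sub>R v + s *\<^sub>R w)) w"
proof -
  let ?D = "\<lambda>x. frechet_derivative f (at x) v"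
  let ?g = "\<lambda>r. f ((p + h *\<^sub>R w) + r *\<^sub>R v) - f (p + r *\<^sub>R v)"
  have "(?g has_real_derivative (?D ((p + h *\<^sub>R w) + r *\<^sub>R v) - ?D (p + r *\<^sub>R v))) (at r)" for r
    by (intro DERIV_diff smooth_has_real_derivative_line f)
  then obtain r where r: "0 < r" "r < h"
    "?g h - ?g 0 = (h - 0) * (?D ((p + h *\<^sub>R w) + r *\<^sub>R v) - ?D (p + r *\<^sub>R v))"
    using MVT2[OF h, of ?g "\<lambda>r. ?D ((p + h *\<^sub>R w) + r *\<^sub>R v) - ?D (p + r *\<^sub>R v)"] by blast
  have "((\<lambda>s. ?D ((p + r *\<^sub>R v) + s *\<^sub>R w)) has_real_derivative
      frechet_derivative ?D (at ((p + r *\<^sub>R v) + s *\<^sub>R w)) w) (at s)" for s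
    by (intro smooth_has_real_derivative_line smooth_frechet_derivative f)
  then obtain s where s: "0 < s" "s < h"
    "?D ((p + r *\<^sub>R v) + h *\<^sub>R w) - ?D ((p + r *\<^sub>R v) + 0 *\<^sub>R w)
      = (h - 0) * frechet_derivative ?D (at ((p + r *\<^sub>R v) + s *\<^sub>R w)) w"
    using MVT2[OF h, of "\<lambda>s. ?D ((p + r *\<^sub>R v) + s *\<^sub>R w)"
        "\<lambda>s. frechet_derivative ?D (at ((p + r *\<^sub>R v) + s *\<^sub>R w)) w"] by blast
  have "p + h *\<^sub>R w + r *\<^sub>R v = p + r *\<^sub>R v + h *\<^sub>R w" "p + h *\<^sub>R w + h *\<^sub>R v = p + h *\<^sub>R v + h *\<^sub>R w"
    by simp_all
  with r(3) s(3) have "f (p + h *\<^sub>R v + h *\<^sub>R w) - f (p + h *\<^sub>R v) - f (p + h *\<^sub>R w) + f p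
      = h * (h * frechet_derivative ?D (at (p + r *\<^sub>R v + s *\<^sub>R w)) w)"
    by simp
  with r(1,2) s(1,2) show ?thesis
    by (intro that[of r s]) (simp_all add: power2_eq_square)
qed

text \<open>The second difference quotient at scale 1 / (n + 1) equals a mixed derivative at a point
  that tends to p, so by continuity it converges to the mixed derivative at p. Exchanging v and w
  leaves the quotient unchanged.\<close>

lemma frechet_derivative_commute:
  assumes f: "smooth (f :: 'a::real_normed_vector \<Rightarrow> real)"
  shows "frechet_derivative (\<lambda>x. frechet_derivative f (at x) v) (at p) w
       = frechet_derivative (\<lambda>x. frechet_derivative f (at x) w) (at p) v"
proof -
  have lim: "\<exists>r s. \<forall>n. 0 < r n \<and> r n < 1 / Suc n \<and> 0 < s n \<and> s n < 1 / Suc n \<and>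
      (f (p + (1 / Suc n) *\<^sub>R v + (1 / Suc n) *\<^sub>R w) - f (p + (1 / Suc n) *\<^sub>R v)
        - f (p + (1 / Suc n) *\<^sub>R w) + f p) / (1 / Suc n)\<^sup>2
      = frechet_derivative (\<lambda>x. frechet_derivative f (at x) v) (at (p + r n *\<^sub>R v + s n *\<^sub>R w)) w"
    for v w
  proof -
    have "\<exists>r s. 0 < r \<and> r < 1 / Suc n \<and> 0 < s \<and> s < 1 / Suc n \<and>
      (f (p + (1 / Suc n) *\<^sub>R v + (1 / Suc n) *\<^sub>R w) - f (p + (1 / Suc n) *\<^sub>R v)
        - f (p + (1 / Suc n) *\<^sub>R w) + f p) / (1 / Suc n)\<^sup>2
      = frechet_derivative (\<lambda>x. frechet_derivative f (at x) v) (at (p + r *\<^sub>R v + s *\<^sub>R w)) w" for n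
      using smooth_second_difference[OF f, of "1 / Suc n" p v w]
      by (metis nonzero_mult_div_cancel_left of_nat_0_less_iff power_eq_0_iff zero_less_Suc
          zero_less_divide_1_iff less_numeral_extra(3))
    then show ?thesis by metis
  qed
  have "(\<lambda>n. (f (p + (1 / Suc n) *\<^sub>R v + (1 / Suc n) *\<^sub>R w) - f (p + (1 / Suc n) *\<^sub>R v)
        - f (p + (1 / Suc n) *\<^sub>R w) + f p) / (1 / Suc n)\<^sup>2)
      \<longlonglongrightarrow> frechet_derivative (\<lambda>x. frechet_derivative f (at x) v) (at p) w" for v w
  proof -
    obtain r s where rs: "\<And>n. 0 < r n" "\<And>n. r n < 1 / Suc n" "\<And>n. 0 < s n" "\<And>n. s n < 1 / Suc n"
      and eq: "\<And>n. (f (p + (1 / Suc n) *\<^sub>R v + (1 / Suc n) *\<^sub>R w) - f (p + (1 / Suc n) *\<^sub>R v)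
        - f (p + (1 / Suc n) *\<^sub>R w) + f p) / (1 / Suc n)\<^sup>2
      = frechet_derivative (\<lambda>x. frechet_derivative f (at x) v) (at (p + r n *\<^sub>R v + s n *\<^sub>R w)) w"
      using lim[of v w] by blast
    have 0: "(\<lambda>n. 1 / real (Suc n)) \<longlonglongrightarrow> 0"
      by (rule LIMSEQ_Suc) (rule lim_1_over_n)
    have "r \<longlonglongrightarrow> 0" "s \<longlonglongrightarrow> 0"
      using rs by (auto intro!: tendsto_sandwich[OF _ _ tendsto_const 0] always_eventually less_imp_le)
    then have "(\<lambda>n. p + r n *\<^sub>R v + s n *\<^sub>R w) \<longlonglongrightarrow> p + 0 *\<^sub>R v + 0 *\<^sub>R w"
      by (intro tendsto_intros)
    then have "(\<lambda>n. p + r n *\<^sub>R v + s n *\<^sub>R w) \<longlonglongrightarrow> p"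
      by simp
    then show ?thesis
      unfolding eq
      by (intro isCont_tendsto_compose[where g = "\<lambda>q. frechet_derivative (\<lambda>x. frechet_derivative f (at x) v) (at q) w"]
          smooth_imp_continuous smooth_frechet_derivative f)
  qed
  \<comment> \<open>The two sequences agree up to reordering the numerator, so their limits
    coincide.\<close>
  from this[of v w] this[of w v] show ?thesis
    by (intro LIMSEQ_unique) (simp_all add: algebra_simps)
qed


section \<open>Fields on spacetime\<close>

abbreviation smooth_field :: "(real \<Rightarrow> real^3 \<Rightarrow> 'b::real_normed_vector) \<Rightarrow> bool" where
  "smooth_field F \<equiv> smooth (case_prod F)"

lemma smooth_field_const: "smooth_field (\<lambda>t x. c)"
  using smooth_const[of c] by (simp add: case_prod_unfold)

lemma smooth_field_add:
  "smooth_field F \<Longrightarrow> smooth_field G \<Longrightarrow> smooth_field (\<lambda>t x. F t x + G t x)"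
  using smooth_add[of "case_prod F" "case_prod G"] by (simp add: case_prod_unfold)

lemma smooth_field_bounded_linear:
  "bounded_linear h \<Longrightarrow> smooth_field F \<Longrightarrow> smooth_field (\<lambda>t x. h (F t x))"
  using smooth_bounded_linear[of h "case_prod F"] by (simp add: case_prod_unfold)

lemma smooth_field_bounded_bilinear:
  "bounded_bilinear h \<Longrightarrow> smooth_field F \<Longrightarrow> smooth_field G \<Longrightarrow> smooth_field (\<lambda>t x. h (F t x) (G t x))"
  using smooth_bounded_bilinear[of h "case_prod F" "case_prod G"] by (simp add: case_prod_unfold)

lemmas smooth_field_minus = smooth_field_bounded_linear[OF bounded_linear_minus[OF bounded_linear_ident]]
lemmas smooth_field_nth = smooth_field_bounded_linear[OF bounded_linear_vec_nth]
lemmas smooth_field_mult = smooth_field_bounded_bilinear[OF bounded_bilinear_mult]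
lemmas smooth_field_scaleR = smooth_field_bounded_bilinear[OF bounded_bilinear_scaleR]
lemmas smooth_field_inner = smooth_field_bounded_bilinear[OF bounded_bilinear_inner]
lemmas smooth_field_cross =
  smooth_field_bounded_bilinear[OF bilinear_conv_bounded_bilinear[THEN iffD1, OF bilinear_cross]]

lemma smooth_field_diff:
  assumes "smooth_field F" "smooth_field G"
  shows "smooth_field (\<lambda>t x. F t x - G t x)"
  using smooth_field_add[OF assms(1) smooth_field_minus[OF assms(2)]] by simp

lemma smooth_field_time: "smooth_field (\<lambda>t x. t)"
  using smooth_linear[OF bounded_linear_fst] by (simp add: case_prod_unfold[abs_def])

lemma smooth_field_space: "smooth_field (\<lambda>t x. x)"
  using smooth_linear[OF bounded_linear_snd] by (simp add: case_prod_unfold[abs_def])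

lemma smooth_field_vec3:
  fixes F :: "real \<Rightarrow> real^3 \<Rightarrow> real^3"
  assumes "\<And>i. smooth_field (\<lambda>t x. F t x $ i)"
  shows "smooth_field F"
proof -
  have "smooth_field (\<lambda>t x. (F t x $ 1) *\<^sub>R axis 1 1 + (F t x $ 2) *\<^sub>R axis 2 1
      + (F t x $ 3) *\<^sub>R (axis 3 1 :: real^3))"
    by (intro smooth_field_add smooth_field_scaleR smooth_field_const assms)
  moreover have "(F t x $ 1) *\<^sub>R axis 1 1 + (F t x $ 2) *\<^sub>R axis 2 1 + (F t x $ 3) *\<^sub>R axis 3 1 = F t x"
    for t x
    by (simp add: vec_eq_iff forall_3 axis_def)
  ultimately show ?thesis
    by simp
qed

lemma smooth_field_has_derivative_time:
  assumes "smooth_field F"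
  shows "((\<lambda>s. F s x) has_derivative (\<lambda>h. frechet_derivative (case_prod F) (at (t, x)) (h, 0))) (at t)"
proof -
  have "((\<lambda>s. (s, x)) has_derivative (\<lambda>h. (h, 0))) (at t)"
    by (auto intro!: derivative_eq_intros)
  from diff_chain_at[OF this smooth_imp_has_derivative[OF assms]]
  show ?thesis by (simp add: o_def)
qed

lemma smooth_field_has_derivative_space:
  assumes "smooth_field F"
  shows "(F t has_derivative (\<lambda>h. frechet_derivative (case_prod F) (at (t, x)) (0, h))) (at x)"
proof -
  have "((\<lambda>y. (t, y)) has_derivative (\<lambda>h. (0, h))) (at x)"
    by (auto intro!: derivative_eq_intros)
  from diff_chain_at[OF this smooth_imp_has_derivative[OF assms]]
  show ?thesis by (simp add: o_def)
qed

lemma smooth_field_differentiable: "smooth_field F \<Longrightarrow> F t differentiable (at x)"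
  using smooth_field_has_derivative_space differentiableI by blast

text \<open>Together with \<open>partial_eq\<close>, this makes both kinds of derivative directional
  derivatives of one map on spacetime, so that smoothness and commutation come from the general
  results above.\<close>

lemma time_deriv_eq:
  assumes "smooth_field F"
  shows "time_deriv F t x = frechet_derivative (case_prod F) (at (t, x)) (1, 0)"
proof -
  have "linear (frechet_derivative (case_prod F) (at (t, x)))"
    by (intro linear_frechet_derivative smooth_imp_differentiable assms)
  then have scale: "frechet_derivative (case_prod F) (at (t, x)) (h *\<^sub>R (1, 0))
      = h *\<^sub>R frechet_derivative (case_prod F) (at (t, x)) (1, 0)" for h
    by (rule linear_cmul)
  have eq: "(\<lambda>h. frechet_derivative (case_prod F) (at (t, x)) (h, 0))
      = (\<lambda>h. h *\<^sub>R frechet_derivative (case_prod F) (at (t, x)) (1, 0))"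
    proof
    show "frechet_derivative (case_prod F) (at (t, x)) (h, 0)
        = h *\<^sub>R frechet_derivative (case_prod F) (at (t, x)) (1, 0)" for h
      using scale[of h] by simp
  qed
  have "((\<lambda>s. F s x) has_vector_derivative frechet_derivative (case_prod F) (at (t, x)) (1, 0)) (at t)"
    using smooth_field_has_derivative_time[OF assms, of x t]
    unfolding has_vector_derivative_def eq .
  then show ?thesis
    by (simp add: time_deriv_def vector_derivative_at)
qed

lemma frechet_derivative_space_eq:
  "smooth_field F \<Longrightarrow>
    frechet_derivative (F t) (at x) h = frechet_derivative (case_prod F) (at (t, x)) (0, h)"
  by (metis frechet_derivative_at[OF smooth_field_has_derivative_space])

lemma partial_eq:
  "smooth_field F \<Longrightarrow> partial i (F t) x = frechet_derivative (case_prod F) (at (t, x)) (0, axis i 1)"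
  by (simp add: partial_def frechet_derivative_space_eq)

lemma smooth_field_time_deriv: "smooth_field F \<Longrightarrow> smooth_field (time_deriv F)"
  using smooth_frechet_derivative[of "case_prod F" "(1, 0)"]
  by (simp add: time_deriv_eq case_prod_unfold)

lemma smooth_field_partial: "smooth_field F \<Longrightarrow> smooth_field (\<lambda>t. partial i (F t))"
  using smooth_frechet_derivative[of "case_prod F" "(0, axis i 1)"]
  by (simp add: partial_eq case_prod_unfold)

lemma partial_commute:
  assumes "smooth_field (F :: real \<Rightarrow> real^3 \<Rightarrow> real)"
  shows "partial i (partial j (F t)) x = partial j (partial i (F t)) x"
proof -
  have eq: "partial i (partial j (F t)) x
      = frechet_derivative (\<lambda>p. frechet_derivative (case_prod F) (at p) (0, axis j 1)) (at (t, x)) (0, axis i 1)"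
    for i j
    using partial_eq[OF smooth_field_partial[OF assms], of i j t x]
    by (simp add: partial_eq[OF assms] case_prod_unfold)
  show ?thesis
    unfolding eq by (rule frechet_derivative_commute[OF assms])
qed

lemma time_deriv_partial:
  assumes "smooth_field (F :: real \<Rightarrow> real^3 \<Rightarrow> real)"
  shows "time_deriv (\<lambda>t. partial i (F t)) t x = partial i (time_deriv F t) x"
proof -
  have "time_deriv (\<lambda>t. partial i (F t)) t x
      = frechet_derivative (\<lambda>p. frechet_derivative (case_prod F) (at p) (0, axis i 1)) (at (t, x)) (1, 0)"
    using time_deriv_eq[OF smooth_field_partial[OF assms], of i t x]
    by (simp add: partial_eq[OF assms] case_prod_unfold)
  also have "\<dots> = frechet_derivative (\<lambda>p. frechet_derivative (case_prod F) (at p) (1, 0)) (at (t, x)) (0, axis i 1)"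
    by (rule frechet_derivative_commute[OF assms])
  also have "\<dots> = partial i (time_deriv F t) x"
    using partial_eq[OF smooth_field_time_deriv[OF assms], of i t x]
    by (simp add: time_deriv_eq[OF assms] case_prod_unfold)
  finally show ?thesis .
qed


section \<open>Evaluation of the forms\<close>

lemma sum_permutes_2:
  "(\<Sum>\<sigma> | \<sigma> permutes {..<2::nat}. g \<sigma>) = g id + g (Transposition.transpose 0 1)"
proof -
  have 2: "{..<2::nat} = insert 0 {1}"
    by auto
  show ?thesis
    unfolding 2
    by (subst sum_over_permutations_insert) (auto simp: permutes_sing)
qed

lemma sum_permutes_3:
  "(\<Sum>\<sigma> | \<sigma> permutes {..<3::nat}. g \<sigma>) =
    g id + g (Transposition.transpose 0 1) + g (Transposition.transpose 1 2) + g (Transposition.transpose 0 2)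
    + g (Transposition.transpose 0 1 \<circ> Transposition.transpose 1 2) + g (Transposition.transpose 0 2 \<circ> Transposition.transpose 1 2)"
proof -
  have 3: "{..<3::nat} = insert 0 (insert 1 {2})"
    by auto
  show ?thesis
    unfolding 3
    apply (subst sum_over_permutations_insert, simp, simp)
    apply (subst sum_over_permutations_insert, simp, simp)
    by (simp add: permutes_sing ac_simps)
qed

lemma wedge_dx_dx:
  "wedge 1 1 (dx i) (dx j) p v = snd (v 0) $ i * snd (v 1) $ j - snd (v 1) $ i * snd (v 0) $ j"
  unfolding wedge_def one_add_one sum_permutes_2 by (simp add: dx_def sign_swap_id)


text \<open>The six permutations pair off under exchange of the two arguments of g. Antisymmetry
  makes the terms of a pair equal, which cancels the normalising factor 2 and leaves the three
  cyclic terms.\<close>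

lemma wedge_2_1:
  assumes "\<And>v. \<omega> p v = g (v 0) (v 1)" and "\<And>a b. g a b = - g b a"
    and "\<And>v. \<beta> p v = h (v 0)"
  shows "wedge 2 1 \<omega> \<beta> p v = g (v 0) (v 1) * h (v 2) + g (v 1) (v 2) * h (v 0) + g (v 2) (v 0) * h (v 1)"
proof -
  have 3: "2 + 1 = (3::nat)" by simp
  show ?thesis
    unfolding wedge_def 3 sum_permutes_3 assms(1,3)
    \<comment> \<open>One instance of antisymmetry for each of the three odd permutations.\<close>
    using assms(2)[of "v 1" "v 0"] assms(2)[of "v 2" "v 1"] assms(2)[of "v 0" "v 2"]
    by (simp add: sign_swap_id sign_compose permutation_swap_id)
qed

lemma volume_form_eq: "volume_form p v = snd (v 0) \<bullet> (snd (v 1) \<times> snd (v 2))"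
  unfolding volume_form_def
  by (subst wedge_2_1[where g = "\<lambda>a b. snd a $ 1 * snd b $ 2 - snd b $ 1 * snd a $ 2"
        and h = "\<lambda>a. snd a $ 3"])
    (simp_all only: wedge_dx_dx dx_def, simp_all add: cross3_simps)

lemma flux_form_eq: "flux_form V p v = V (fst p) (snd p) \<bullet> (snd (v 0) \<times> snd (v 1))"
  unfolding flux_form_def wedge_dx_dx by (cases p) (simp add: cross3_simps)

lemma wedge_flux_form_dt:
  "wedge 2 1 (flux_form V) dt p v = V (fst p) (snd p) \<bullet>
     (fst (v 2) *\<^sub>R (snd (v 0) \<times> snd (v 1)) + fst (v 0) *\<^sub>R (snd (v 1) \<times> snd (v 2))
        + fst (v 1) *\<^sub>R (snd (v 2) \<times> snd (v 0)))"
  by (subst wedge_2_1[where g = "\<lambda>a b. V (fst p) (snd p) \<bullet> (snd a \<times> snd b)" and h = fst])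
    (simp_all only: flux_form_eq dt_def, simp_all add: cross3_simps)


section \<open>Vector calculus\<close>

lemma frechet_derivative_bounded_linear:
  assumes "bounded_linear h" "f differentiable (at x)"
  shows "frechet_derivative (\<lambda>x. h (f x)) (at x) v = h (frechet_derivative f (at x) v)"
  using frechet_derivative_at[OF bounded_linear.has_derivative[OF assms(1) assms(2)[unfolded frechet_derivative_works]]]
  by (simp add: fun_eq_iff)

lemma frechet_derivative_add:
  assumes "f differentiable (at x)" "g differentiable (at x)"
  shows "frechet_derivative (\<lambda>x. f x + g x) (at x) v
      = frechet_derivative f (at x) v + frechet_derivative g (at x) v"
  using frechet_derivative_at[OF has_derivative_add[OF assms[unfolded frechet_derivative_works]]]
  by (simp add: fun_eq_iff)

lemma frechet_derivative_diff:
  assumes "f differentiable (at x)" "g differentiable (at x)"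
  shows "frechet_derivative (\<lambda>x. f x - g x) (at x) v
      = frechet_derivative f (at x) v - frechet_derivative g (at x) v"
  using frechet_derivative_at[OF has_derivative_diff[OF assms[unfolded frechet_derivative_works]]]
  by (simp add: fun_eq_iff)

lemma frechet_derivative_bounded_bilinear:
  assumes "bounded_bilinear h" "f differentiable (at x)" "g differentiable (at x)"
  shows "frechet_derivative (\<lambda>x. h (f x) (g x)) (at x) v
      = h (f x) (frechet_derivative g (at x) v) + h (frechet_derivative f (at x) v) (g x)"
  using frechet_derivative_at[OF bounded_bilinear.FDERIV[OF assms(1) assms(2,3)[unfolded frechet_derivative_works]]]
  by (simp add: fun_eq_iff)

lemma partial_nth:
  "F differentiable (at x) \<Longrightarrow> partial i (\<lambda>y. F y $ j) x = frechet_derivative F (at x) (axis i 1) $ j"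
  unfolding partial_def by (rule frechet_derivative_bounded_linear[OF bounded_linear_vec_nth])

lemma frechet_derivative_grad:
  fixes F :: "real^3 \<Rightarrow> real"
  assumes "F differentiable (at x)"
  shows "frechet_derivative F (at x) h = h \<bullet> grad F x"
proof -
  have "frechet_derivative F (at x) (\<Sum>i\<in>UNIV. h $ i *\<^sub>R axis i 1) = h \<bullet> grad F x"
    using linear_frechet_derivative[OF assms]
    by (simp add: linear_sum linear_cmul grad_def partial_def inner_vec_def)
  then show ?thesis
    by (simp only: basis_expansion[of h, unfolded scalar_mult_eq_scaleR])
qed

lemma frechet_derivative_nth:
  fixes F :: "real^3 \<Rightarrow> real^3"
  assumes "F differentiable (at x)"
  shows "frechet_derivative F (at x) h $ i = (\<Sum>j\<in>UNIV. h $ j * partial j (\<lambda>y. F y $ i) x)"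
proof -
  have "(\<lambda>y. F y $ i) differentiable (at x)"
    using assms bounded_linear.has_derivative[OF bounded_linear_vec_nth] unfolding differentiable_def by blast
  from frechet_derivative_grad[OF this, of h] show ?thesis
    using frechet_derivative_bounded_linear[OF bounded_linear_vec_nth assms]
    by (simp add: inner_vec_def grad_def)
qed

text \<open>The triple product is a determinant, on which a linear map acts as a derivation by
  multiplication with its trace; the trace of the Jacobian is the divergence. This is the pointwise
  form of L_u vol = (div u) vol.\<close>

lemma frechet_derivative_trace:
  fixes F :: "real^3 \<Rightarrow> real^3"
  assumes "F differentiable (at x)"
  shows "frechet_derivative F (at x) a \<bullet> (b \<times> c) + a \<bullet> (frechet_derivative F (at x) b \<times> c)
      + a \<bullet> (b \<times> frechet_derivative F (at x) c) = divergence F x * (a \<bullet> (b \<times> c))"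
  by (simp add: cross3_simps frechet_derivative_nth[OF assms] divergence_def)

text \<open>The curl is the axial vector of the antisymmetric part of the Jacobian: both sides are
  -dF(a, b), with F read as a 1-form.\<close>

lemma cross_curl_inner:
  assumes "F differentiable (at x)"
  shows "(a \<times> curl F x) \<bullet> b = a \<bullet> frechet_derivative F (at x) b - frechet_derivative F (at x) a \<bullet> b"
  by (simp add: cross3_simps frechet_derivative_nth[OF assms] curl_def)

lemma partial_diff:
  "f differentiable (at x) \<Longrightarrow> g differentiable (at x) \<Longrightarrow>
    partial i (\<lambda>y. f y - g y) x = partial i f x - partial i g x"
  by (simp add: partial_def frechet_derivative_diff)

lemma divergence_diff:
  assumes F: "F differentiable (at x)" and G: "G differentiable (at x)"
  shows "divergence (\<lambda>y. F y - G y) x = divergence F x - divergence G x"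
  unfolding divergence_def partial_nth[OF differentiable_diff[OF F G]] partial_nth[OF F] partial_nth[OF G]
  by (simp add: frechet_derivative_diff[OF F G] sum_subtractf)

lemma divergence_scaleR:
  assumes f: "f differentiable (at x)" and G: "G differentiable (at x)"
  shows "divergence (\<lambda>y. f y *\<^sub>R G y) x = G x \<bullet> grad f x + f x * divergence G x"
  unfolding divergence_def partial_nth[OF differentiable_scaleR[OF f G]] partial_nth[OF G]
  by (simp add: frechet_derivative_bounded_bilinear[OF bounded_bilinear_scaleR f G] inner_vec_def
      grad_def partial_def sum.distrib sum_distrib_left mult.commute)

lemma smooth_field_grad: "smooth_field F \<Longrightarrow> smooth_field (\<lambda>t. grad (F t))"
  by (rule smooth_field_vec3) (simp add: grad_def smooth_field_partial)

lemma smooth_field_curl: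
  assumes "smooth_field F"
  shows "smooth_field (\<lambda>t. curl (F t))"
proof (rule smooth_field_vec3)
  fix i :: 3
  have "smooth_field (\<lambda>t x. partial j (\<lambda>y. F t y $ k) x - partial l (\<lambda>y. F t y $ m) x)" for j k l m
    using assms by (intro smooth_field_diff smooth_field_partial smooth_field_nth)
  then show "smooth_field (\<lambda>t x. curl (F t) x $ i)"
    using exhaust_3[of i] by (auto simp: curl_def)
qed

lemma smooth_field_divergence: "smooth_field F \<Longrightarrow> smooth_field (\<lambda>t. divergence (F t))"
  unfolding divergence_def sum_3
  by (intro smooth_field_add smooth_field_partial smooth_field_nth)

lemma time_deriv_bounded_linear:
  assumes h: "bounded_linear h" and F: "smooth_field F"
  shows "time_deriv (\<lambda>t x. h (F t x)) t x = h (time_deriv F t x)"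
  using frechet_derivative_bounded_linear[OF h smooth_imp_differentiable[OF F], of "(t, x)" "(1, 0)"]
  unfolding time_deriv_eq[OF F] time_deriv_eq[OF smooth_field_bounded_linear[OF h F]]
  by (simp add: case_prod_unfold)

lemmas time_deriv_nth = time_deriv_bounded_linear[OF bounded_linear_vec_nth]

lemma time_deriv_diff:
  assumes F: "smooth_field F" and G: "smooth_field G"
  shows "time_deriv (\<lambda>t x. F t x - G t x) t x = time_deriv F t x - time_deriv G t x"
  using frechet_derivative_diff[OF smooth_imp_differentiable[OF F] smooth_imp_differentiable[OF G], of "(t, x)" "(1, 0)"]
  unfolding time_deriv_eq[OF F] time_deriv_eq[OF G] time_deriv_eq[OF smooth_field_diff[OF F G]]
  by (simp add: case_prod_unfold)

lemma time_deriv_add: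
  assumes F: "smooth_field F" and G: "smooth_field G"
  shows "time_deriv (\<lambda>t x. F t x + G t x) t x = time_deriv F t x + time_deriv G t x"
  using frechet_derivative_add[OF smooth_imp_differentiable[OF F] smooth_imp_differentiable[OF G], of "(t, x)" "(1, 0)"]
  unfolding time_deriv_eq[OF F] time_deriv_eq[OF G] time_deriv_eq[OF smooth_field_add[OF F G]]
  by (simp add: case_prod_unfold)

lemma time_deriv_bounded_bilinear:
  assumes h: "bounded_bilinear h" and F: "smooth_field F" and G: "smooth_field G"
  shows "time_deriv (\<lambda>t x. h (F t x) (G t x)) t x = h (F t x) (time_deriv G t x) + h (time_deriv F t x) (G t x)"
  using frechet_derivative_bounded_bilinear[OF h smooth_imp_differentiable[OF F] smooth_imp_differentiable[OF G], of "(t, x)" "(1, 0)"]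
  unfolding time_deriv_eq[OF F] time_deriv_eq[OF G] time_deriv_eq[OF smooth_field_bounded_bilinear[OF h F G]]
  by (simp add: case_prod_unfold)

lemma time_deriv_divergence:
  assumes F: "smooth_field F"
  shows "time_deriv (\<lambda>t. divergence (F t)) t x = divergence (time_deriv F t) x"
proof -
  note Fi = smooth_field_nth[OF F]
  have "time_deriv (\<lambda>t. divergence (F t)) t x = (\<Sum>i\<in>UNIV. time_deriv (\<lambda>t. partial i (\<lambda>y. F t y $ i)) t x)"
    unfolding divergence_def[abs_def] sum_3
    by (simp only: time_deriv_add smooth_field_add smooth_field_partial Fi)
  then show ?thesis
    by (simp add: divergence_def time_deriv_partial[OF Fi] flip: time_deriv_nth[OF F])
qed

lemma divergence_curl:
  assumes F: "smooth_field F"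
  shows "divergence (curl (F t)) x = 0"
proof -
  note Fi = smooth_field_nth[OF F]
  note d = smooth_field_differentiable[OF smooth_field_partial[OF Fi]]
  have "divergence (curl (F t)) x =
     (partial 1 (partial 2 (\<lambda>y. F t y $ 3)) x - partial 1 (partial 3 (\<lambda>y. F t y $ 2)) x)
   + (partial 2 (partial 3 (\<lambda>y. F t y $ 1)) x - partial 2 (partial 1 (\<lambda>y. F t y $ 3)) x)
   + (partial 3 (partial 1 (\<lambda>y. F t y $ 2)) x - partial 3 (partial 2 (\<lambda>y. F t y $ 1)) x)"
    unfolding divergence_def sum_3 curl_def vector_3 by (simp only: partial_diff d)
  then show ?thesis
    using partial_commute[OF Fi] by simp
qed

lemma smooth_field_frechet_derivative:
  assumes F: "smooth_field F"
  shows "frechet_derivative (case_prod F) (at (t, x)) (a, h)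
    = a *\<^sub>R time_deriv F t x + frechet_derivative (F t) (at x) h"
proof -
  have lin: "linear (frechet_derivative (case_prod F) (at (t, x)))"
    by (intro linear_frechet_derivative smooth_imp_differentiable F)
  have "(a, h) = a *\<^sub>R (1, 0) + (0, h)"
    by simp
  then show ?thesis
    by (simp only: linear_add[OF lin] linear_cmul[OF lin] time_deriv_eq[OF F] frechet_derivative_space_eq[OF F])
qed


section \<open>The Lie derivative of a current form\<close>

text \<open>Density and current are arbitrary here, which separates the Lie derivative from the
  relations that tie \<open>charge\<close> and \<open>current\<close> to the fields.\<close>

definition current_form ::
  "(real \<Rightarrow> real^3 \<Rightarrow> real) \<Rightarrow> (real \<Rightarrow> real^3 \<Rightarrow> real^3) \<Rightarrow> spacetime form" where
  "current_form q J p v =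
     (case p of (t, x) \<Rightarrow> q t x * volume_form p v) - wedge 2 1 (flux_form J) dt p v"

lemma current_form_eq:
  "current_form q J p v = case_prod q p * (snd (v 0) \<bullet> (snd (v 1) \<times> snd (v 2)))
     - case_prod J p \<bullet> (fst (v 2) *\<^sub>R (snd (v 0) \<times> snd (v 1)) + fst (v 0) *\<^sub>R (snd (v 1) \<times> snd (v 2))
        + fst (v 1) *\<^sub>R (snd (v 2) \<times> snd (v 0)))"
  unfolding current_form_def volume_form_eq wedge_flux_form_dt by (simp add: case_prod_unfold)

text \<open>The algebra behind the Lie derivative of a contraction. Primes stand for the Jacobian of
  u applied to a vector, w for the time derivative of u, d for its divergence, and \<alpha>,
  \<beta>, \<gamma> for the time components of the three arguments. The assumptions are the trace
  identity for (a, b, c), (J, a, b), (J, b, c) and (J, c, a). Terms pairing J with w cancel by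
  antisymmetry of the cross product.\<close>

lemma contraction_identity:
  fixes a b c J w a' b' c' J' :: "real^3"
  assumes "a' \<bullet> (b \<times> c) + a \<bullet> (b' \<times> c) + a \<bullet> (b \<times> c') = d * (a \<bullet> (b \<times> c))"
    and "J' \<bullet> (a \<times> b) + J \<bullet> (a' \<times> b) + J \<bullet> (a \<times> b') = d * (J \<bullet> (a \<times> b))"
    and "J' \<bullet> (b \<times> c) + J \<bullet> (b' \<times> c) + J \<bullet> (b \<times> c') = d * (J \<bullet> (b \<times> c))"
    and "J' \<bullet> (c \<times> a) + J \<bullet> (c' \<times> a) + J \<bullet> (c \<times> a') = d * (J \<bullet> (c \<times> a))"
  shows "q * ((\<alpha> *\<^sub>R w + a') \<bullet> (b \<times> c) + a \<bullet> ((\<beta> *\<^sub>R w + b') \<times> c) + a \<bullet> (b \<times> (\<gamma> *\<^sub>R w + c')))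
      - J \<bullet> ((\<gamma> *\<^sub>R ((\<alpha> *\<^sub>R w + a') \<times> b) + \<beta> *\<^sub>R (c \<times> (\<alpha> *\<^sub>R w + a')))
           + (\<gamma> *\<^sub>R (a \<times> (\<beta> *\<^sub>R w + b')) + \<alpha> *\<^sub>R ((\<beta> *\<^sub>R w + b') \<times> c))
           + (\<alpha> *\<^sub>R (b \<times> (\<gamma> *\<^sub>R w + c')) + \<beta> *\<^sub>R ((\<gamma> *\<^sub>R w + c') \<times> a)))
    = d * q * (a \<bullet> (b \<times> c))
      - (d *\<^sub>R J - J' - q *\<^sub>R w) \<bullet> (\<gamma> *\<^sub>R (a \<times> b) + \<alpha> *\<^sub>R (b \<times> c) + \<beta> *\<^sub>R (c \<times> a))"
proof -
  have "q * (a' \<bullet> (b \<times> c) + a \<bullet> (b' \<times> c) + a \<bullet> (b \<times> c'))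
      - \<gamma> * (J' \<bullet> (a \<times> b) + J \<bullet> (a' \<times> b) + J \<bullet> (a \<times> b'))
      - \<alpha> * (J' \<bullet> (b \<times> c) + J \<bullet> (b' \<times> c) + J \<bullet> (b \<times> c'))
      - \<beta> * (J' \<bullet> (c \<times> a) + J \<bullet> (c' \<times> a) + J \<bullet> (c \<times> a'))
      = q * (d * (a \<bullet> (b \<times> c))) - \<gamma> * (d * (J \<bullet> (a \<times> b))) - \<alpha> * (d * (J \<bullet> (b \<times> c)))
      - \<beta> * (d * (J \<bullet> (c \<times> a)))"
    unfolding assms ..
  then show ?thesis
    by (simp add: cross3_simps)
qed

text \<open>The constant field contributes no derivative, and the constant time component of
  \<open>material_field\<close> makes the bracket purely spatial.\<close>

lemma lie_bracket_material_field:
  assumes u: "smooth_field u"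
  shows "lie_bracket (material_field u) (\<lambda>_. w) (t, x)
    = - (0, fst w *\<^sub>R time_deriv u t x + frechet_derivative (u t) (at x) (snd w))"
proof -
  have "material_field u = (\<lambda>p. (1, case_prod u p))"
    by (auto simp: material_field_def)
  then have "(material_field u has_derivative (\<lambda>h. (0, frechet_derivative (case_prod u) (at (t, x)) h))) (at (t, x))"
    by (auto intro!: has_derivative_Pair smooth_imp_has_derivative u)
  from frechet_derivative_at[OF this, symmetric] show ?thesis
    by (cases w) (simp add: lie_bracket_def smooth_field_frechet_derivative[OF u])
qed

text \<open>The right side is again a current form: its density and current are the time and space
  components of [X, Y] + (div u) Y for X = (1, u), Y = (q, J). The last term of the current arises
  because Y has time component q and X depends on time.\<close>

lemma lie_derivative_current_form:
  assumes u: "smooth_field u" and q: "smooth_field q" and J: "smooth_field J"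
  shows "lie_derivative 3 (material_field u) (current_form q J) (t, x) v =
    (time_deriv q t x + u t x \<bullet> grad (q t) x + divergence (u t) x * q t x)
        * (snd (v 0) \<bullet> (snd (v 1) \<times> snd (v 2)))
    - (time_deriv J t x + lie_bracket (u t) (J t) x + divergence (u t) x *\<^sub>R J t x - q t x *\<^sub>R time_deriv u t x)
        \<bullet> (fst (v 2) *\<^sub>R (snd (v 0) \<times> snd (v 1)) + fst (v 0) *\<^sub>R (snd (v 1) \<times> snd (v 2))
           + fst (v 1) *\<^sub>R (snd (v 2) \<times> snd (v 0)))"
proof -
  note ud = smooth_field_differentiable[OF u]
  let ?M = "frechet_derivative (u t) (at x)"
  obtain \<alpha> a \<beta> b \<gamma> c where v: "v 0 = (\<alpha>, a)" "v 1 = (\<beta>, b)" "v 2 = (\<gamma>, c)"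
    by (metis surj_pair)
  let ?S = "\<gamma> *\<^sub>R (a \<times> b) + \<alpha> *\<^sub>R (b \<times> c) + \<beta> *\<^sub>R (c \<times> a)"
  have deriv: "frechet_derivative (\<lambda>p. current_form q J p v) (at (t, x)) (material_field u (t, x))
    = (time_deriv q t x + u t x \<bullet> grad (q t) x) * (a \<bullet> (b \<times> c))
      - (time_deriv J t x + frechet_derivative (J t) (at x) (u t x)) \<bullet> ?S"
  proof -
    have "((\<lambda>p. current_form q J p v) has_derivative (\<lambda>h.
        frechet_derivative (case_prod q) (at (t, x)) h * (a \<bullet> (b \<times> c))
        - frechet_derivative (case_prod J) (at (t, x)) h \<bullet> ?S)) (at (t, x))"
      unfolding current_form_eq v fst_conv snd_conv
      by (intro has_derivative_diff has_derivative_mult_left has_derivative_inner_left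
          smooth_imp_has_derivative q J)
    from frechet_derivative_at[OF this, symmetric] show ?thesis
      by (simp add: material_field_def smooth_field_frechet_derivative q J
          frechet_derivative_grad smooth_field_differentiable)
  qed
  have "(\<Sum>i<3. current_form q J (t, x) (v(i := lie_bracket (material_field u) (\<lambda>_. v i) (t, x))))
    = - (d * q t x * (a \<bullet> (b \<times> c))
      - (d *\<^sub>R J t x - ?M (J t x) - q t x *\<^sub>R time_deriv u t x) \<bullet> ?S)"
    if "d = divergence (u t) x" for d
    \<comment> \<open>Read from right to left, the identity restores the expression in which one
      argument at a time is replaced by its bracket, as in the sum on the left.\<close>
    unfolding that contraction_identity[OF frechet_derivative_trace[OF ud] frechet_derivative_trace[OF ud]
        frechet_derivative_trace[OF ud] frechet_derivative_trace[OF ud], symmetric]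
  proof -
    define a' b' c' where "a' = \<alpha> *\<^sub>R time_deriv u t x + ?M a"
      and "b' = \<beta> *\<^sub>R time_deriv u t x + ?M b" and "c' = \<gamma> *\<^sub>R time_deriv u t x + ?M c"
    then have "lie_bracket (material_field u) (\<lambda>_. v 0) (t, x) = - (0, a')"
      "lie_bracket (material_field u) (\<lambda>_. v 1) (t, x) = - (0, b')"
      "lie_bracket (material_field u) (\<lambda>_. v 2) (t, x) = - (0, c')"
      by (simp_all only: lie_bracket_material_field[OF u] v fst_conv snd_conv)
    moreover have "{..<3::nat} = {0, 1, 2}"
      by auto
    ultimately show "(\<Sum>i<3. current_form q J (t, x) (v(i := lie_bracket (material_field u) (\<lambda>_. v i) (t, x))))
      = - (q t x * (a' \<bullet> (b \<times> c) + a \<bullet> (b' \<times> c) + a \<bullet> (b \<times> c'))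
        - J t x \<bullet> ((\<gamma> *\<^sub>R (a' \<times> b) + \<beta> *\<^sub>R (c \<times> a')) + (\<gamma> *\<^sub>R (a \<times> b') + \<alpha> *\<^sub>R (b' \<times> c))
          + (\<alpha> *\<^sub>R (b \<times> c') + \<beta> *\<^sub>R (c' \<times> a))))"
      using v by (simp add: current_form_eq inner_simps algebra_simps)
  qed
  note sum = this[OF refl]
  show ?thesis
    unfolding lie_derivative_def deriv sum v fst_conv snd_conv
    by (simp add: lie_bracket_def algebra_simps inner_simps)
qed

text \<open>A current form vanishes only if its density and its current do: suitable triples of
  tangent vectors isolate each component.\<close>

lemma absolute_invariant_current_form_iff:
  assumes u: "smooth_field u" and q: "smooth_field q" and J: "smooth_field J"
  shows "absolute_invariant 3 u (current_form q J) \<longleftrightarrow>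
    (\<forall>t x. time_deriv q t x + u t x \<bullet> grad (q t) x + divergence (u t) x * q t x = 0 \<and>
      time_deriv J t x + lie_bracket (u t) (J t) x + divergence (u t) x *\<^sub>R J t x - q t x *\<^sub>R time_deriv u t x = 0)"
    (is "?I \<longleftrightarrow> (\<forall>t x. ?Q t x = 0 \<and> ?Z t x = 0)")
proof
  assume ?I
  then have zero: "?Q t x * (snd (v 0) \<bullet> (snd (v 1) \<times> snd (v 2))) - ?Z t x
        \<bullet> (fst (v 2) *\<^sub>R (snd (v 0) \<times> snd (v 1)) + fst (v 0) *\<^sub>R (snd (v 1) \<times> snd (v 2))
           + fst (v 1) *\<^sub>R (snd (v 2) \<times> snd (v 0))) = 0" for t x and v :: "nat \<Rightarrow> spacetime"
    unfolding absolute_invariant_def lie_derivative_current_form[OF assms, symmetric] by blast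
  show "\<forall>t x. ?Q t x = 0 \<and> ?Z t x = 0"
  proof (intro allI conjI)
    fix t x
    let ?v = "\<lambda>a b c i. if i = 0 then a else if i = 1 then b else (c :: spacetime)"
    \<comment> \<open>Three spatial basis vectors have no time component, so only the triple
      product, equal to 1, survives.\<close>
    show "?Q t x = 0"
      using zero[of t x "?v (0, axis 1 1) (0, axis 2 1) (0, axis 3 1)"] by (simp add: cross_basis)
    \<comment> \<open>A unit time vector as third argument removes the triple product; cyclic pairs
      of basis vectors then give the components of the current.\<close>
    have "?Z t x \<bullet> (a \<times> b) = 0" for a b
      using zero[of t x "?v (0, a) (0, b) (1, 0)"] by simp
    from this[of "axis 1 1" "axis 2 1"] this[of "axis 2 1" "axis 3 1"] this[of "axis 3 1" "axis 1 1"]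
    show "?Z t x = 0"
      unfolding cross_basis inner_axis by (simp add: vec_eq_iff forall_3)
  qed
next
  assume "\<forall>t x. ?Q t x = 0 \<and> ?Z t x = 0"
  then show ?I
    unfolding absolute_invariant_def by (auto simp: lie_derivative_current_form[OF assms])
qed

text \<open>The product rule gives u . grad q + q div u - div J, and conservation turns - div J into
  the time derivative of q.\<close>

lemma divergence_relative_current:
  assumes u: "smooth_field u" and q: "smooth_field q" and J: "smooth_field J"
    and cons: "\<And>t x. time_deriv q t x + divergence (J t) x = 0"
  shows "divergence (\<lambda>y. q t y *\<^sub>R u t y - J t y) x
    = time_deriv q t x + u t x \<bullet> grad (q t) x + divergence (u t) x * q t x"
  using cons[of t x]
  by (simp add: divergence_diff divergence_scaleR differentiable_scaleR smooth_field_differentiable u q J)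

text \<open>Here [u, q u] = (u . grad q) u, and the time derivative of q u contributes the term q
  du/dt that is subtracted in the residual of J.\<close>

lemma symmetry_relative_current:
  fixes t x
  assumes u: "smooth_field u" and q: "smooth_field q" and J: "smooth_field J"
  defines "V \<equiv> \<lambda>t y. q t y *\<^sub>R u t y - J t y"
  shows "time_deriv V t x + lie_bracket (u t) (V t) x + divergence (u t) x *\<^sub>R V t x
    = (time_deriv q t x + u t x \<bullet> grad (q t) x + divergence (u t) x * q t x) *\<^sub>R u t x
      - (time_deriv J t x + lie_bracket (u t) (J t) x + divergence (u t) x *\<^sub>R J t x - q t x *\<^sub>R time_deriv u t x)"
proof -
  note d = smooth_field_differentiable[OF u] smooth_field_differentiable[OF q] smooth_field_differentiable[OF J]
  have "time_deriv V t x = q t x *\<^sub>R time_deriv u t x + time_deriv q t x *\<^sub>R u t x - time_deriv J t x"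
    unfolding V_def
    by (simp only: time_deriv_diff time_deriv_bounded_bilinear[OF bounded_bilinear_scaleR] smooth_field_scaleR u q J)
  moreover have "frechet_derivative (V t) (at x) h
      = q t x *\<^sub>R frechet_derivative (u t) (at x) h + (h \<bullet> grad (q t) x) *\<^sub>R u t x - frechet_derivative (J t) (at x) h" for h
    unfolding V_def
    by (simp only: frechet_derivative_diff frechet_derivative_bounded_bilinear[OF bounded_bilinear_scaleR]
        differentiable_scaleR frechet_derivative_grad d)
  moreover have "linear (frechet_derivative (u t) (at x))"
    by (intro linear_frechet_derivative d)
  ultimately show ?thesis
    by (simp add: lie_bracket_def V_def[abs_def] linear_diff linear_cmul algebra_simps)
qed

text \<open>With Q and Z the scalar and vector residuals of invariance, the residuals on the other
  side are Q and Q u - Z. This change is triangular, so both pairs vanish together.\<close>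

lemma absolute_invariant_iff_symmetry:
  assumes u: "smooth_field u" and q: "smooth_field q" and J: "smooth_field J"
    and cons: "\<And>t x. time_deriv q t x + divergence (J t) x = 0"
  shows "absolute_invariant 3 u (current_form q J) \<longleftrightarrow>
    divergence_free (\<lambda>t x. q t x *\<^sub>R u t x - J t x) \<and>
    time_dependent_symmetry u (\<lambda>t x. q t x *\<^sub>R u t x - J t x)"
proof -
  have "time_dependent_symmetry u V \<longleftrightarrow>
      (\<forall>t x. time_deriv V t x + lie_bracket (u t) (V t) x + divergence (u t) x *\<^sub>R V t x = 0)" for V
    by (simp add: time_dependent_symmetry_def eq_neg_iff_add_eq_0)
  then show ?thesis
    unfolding absolute_invariant_current_form_iff[OF u q J] divergence_free_def
      divergence_relative_current[OF u q J cons]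
    by (auto simp: symmetry_relative_current[OF u q J])
qed


section \<open>The charge and the current\<close>

lemma smooth_fieldsD:
  assumes "smooth_fields f"
  shows "smooth_field (vel f)" "smooth_field (pot f)" "smooth_field (mag f)"
    "smooth_field (phi f)" "smooth_field (psi f)"
  using assms by (auto simp: smooth_fields_def)

lemma smooth_field_electric:
  assumes "smooth_fields f"
  shows "smooth_field (electric f)"
proof -
  have "electric f = (\<lambda>t x. - (grad (phi f t) x + vel f t x \<times> mag f t x))"
    by (simp add: electric_def fun_eq_iff)
  then show ?thesis
    by (simp only:) (intro smooth_field_minus smooth_field_add smooth_field_grad smooth_field_cross smooth_fieldsD assms)
qed

lemma smooth_field_charge:
  assumes "smooth_fields f"
  shows "smooth_field (charge f)"
proof -
  have "charge f = (\<lambda>t. divergence (electric f t))"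
    by (simp add: charge_def fun_eq_iff)
  with smooth_field_electric[OF assms] show ?thesis
    by (simp add: smooth_field_divergence)
qed

lemma current_eq: "current f = (\<lambda>t x. curl (mag f t) x - time_deriv (electric f) t x)"
  by (simp add: current_def fun_eq_iff)

lemma smooth_field_current:
  assumes "smooth_fields f"
  shows "smooth_field (current f)"
  unfolding current_eq
  by (intro smooth_field_diff smooth_field_curl smooth_field_time_deriv smooth_field_electric
      smooth_fieldsD assms)

text \<open>The displacement term in the current has the time derivative of \<open>charge\<close> as
  its divergence, up to sign, and the curl term has divergence zero.\<close>

lemma charge_conservation:
  assumes f: "smooth_fields f"
  shows "time_deriv (charge f) t x + divergence (current f t) x = 0"
proof -
  note E = smooth_field_electric[OF f] and B = smooth_fieldsD(3)[OF f]
  have "charge f = (\<lambda>t. divergence (electric f t))"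
    by (simp add: charge_def fun_eq_iff)
  then have "time_deriv (charge f) t x = divergence (time_deriv (electric f) t) x"
    by (simp add: time_deriv_divergence[OF E])
  moreover have "divergence (current f t) x = divergence (curl (mag f t)) x - divergence (time_deriv (electric f) t) x"
    unfolding current_eq
    by (intro divergence_diff smooth_field_differentiable smooth_field_curl smooth_field_time_deriv E B)
  ultimately show ?thesis
    by (simp add: divergence_curl[OF B])
qed

lemma Theta_E_eq: "Theta_E f = current_form (charge f) (current f)"
  by (simp add: Theta_E_def current_form_def fun_eq_iff)

lemma relative_current_eq: "relative_current f = (\<lambda>t x. charge f t x *\<^sub>R vel f t x - current f t x)"
  by (simp add: relative_current_def fun_eq_iff)

lemma smooth_field_relative_current:
  "smooth_fields f \<Longrightarrow> smooth_field (relative_current f)"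
  unfolding relative_current_eq
  by (intro smooth_field_diff smooth_field_scaleR smooth_field_charge smooth_field_current smooth_fieldsD)

lemma absolute_invariant_Theta_E_iff:
  assumes "smooth_fields f"
  shows "absolute_invariant 3 (vel f) (Theta_E f) \<longleftrightarrow>
    divergence_free (relative_current f) \<and> time_dependent_symmetry (vel f) (relative_current f)"
  unfolding Theta_E_eq relative_current_eq
  by (intro absolute_invariant_iff_symmetry smooth_fieldsD smooth_field_charge smooth_field_current
      charge_conservation assms)

text \<open>The scalar half of invariance is a continuity equation for the charge, which reduces to
  transport in a divergence-free flow.\<close>

lemma lagrangian_invariant_charge:
  assumes f: "smooth_fields f" and inv: "absolute_invariant 3 (vel f) (Theta_E f)"
    and "divergence_free (vel f)"
  shows "lagrangian_invariant (vel f) (charge f)"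
  using inv \<open>divergence_free (vel f)\<close>
  unfolding Theta_E_eq absolute_invariant_current_form_iff[OF smooth_fieldsD(1)[OF f] smooth_field_charge[OF f] smooth_field_current[OF f]]
  by (simp add: lagrangian_invariant_def divergence_free_def)


section \<open>Conservation of the density\<close>

text \<open>The evolution equation for \<open>A\<close> says that the Lie derivative of the 1-form \<open>A \<cdot> dx\<close> along
  \<open>\<partial>_t + u\<close> is the spatial differential of \<open>\<phi> + \<psi> + u \<cdot> A\<close>. Contracting it with the symmetry
  \<open>W\<close> gives \<open>(\<partial>_t + u \<cdot> \<nabla>) (A \<cdot> W) = W \<cdot> \<nabla>(\<phi> + \<psi> + u \<cdot> A) - (\<nabla> \<cdot> u) A \<cdot> W\<close>.\<close>

lemma potential_symmetry_conservation:
  assumes u: "smooth_field u" and A: "smooth_field A" and W: "smooth_field W" and h: "smooth_field h"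
    and A_eq: "\<And>t x. time_deriv A t x - u t x \<times> curl (A t) x = grad (h t) x"
    and div: "divergence_free W" and sym: "time_dependent_symmetry u W"
  shows "time_deriv (\<lambda>t x. A t x \<bullet> W t x) t x
    + divergence (\<lambda>y. (A t y \<bullet> W t y) *\<^sub>R u t y - (h t y + u t y \<bullet> A t y) *\<^sub>R W t y) x = 0"
proof -
  note d = smooth_field_differentiable[OF u, of t x] smooth_field_differentiable[OF A, of t x]
    smooth_field_differentiable[OF W, of t x] smooth_field_differentiable[OF h, of t x]
  have dAW: "(\<lambda>y. A t y \<bullet> W t y) differentiable (at x)" and duA: "(\<lambda>y. u t y \<bullet> A t y) differentiable (at x)"
    by (intro smooth_field_differentiable smooth_field_inner u A W)+
  have dh: "(\<lambda>y. h t y + u t y \<bullet> A t y) differentiable (at x)"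
    by (intro differentiable_add d duA)
  have "divergence (W t) x = 0"
    using div by (simp add: divergence_free_def)
  then have "divergence (\<lambda>y. (A t y \<bullet> W t y) *\<^sub>R u t y - (h t y + u t y \<bullet> A t y) *\<^sub>R W t y) x
      = frechet_derivative (\<lambda>y. A t y \<bullet> W t y) (at x) (u t x) + (A t x \<bullet> W t x) * divergence (u t) x
        - frechet_derivative (\<lambda>y. h t y + u t y \<bullet> A t y) (at x) (W t x)"
    using d dAW dh
    by (simp add: divergence_diff divergence_scaleR differentiable_scaleR frechet_derivative_grad)
  also have "\<dots> = A t x \<bullet> frechet_derivative (W t) (at x) (u t x) + frechet_derivative (A t) (at x) (u t x) \<bullet> W t x
      + (A t x \<bullet> W t x) * divergence (u t) x
      - (W t x \<bullet> grad (h t) x + u t x \<bullet> frechet_derivative (A t) (at x) (W t x)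
         + frechet_derivative (u t) (at x) (W t x) \<bullet> A t x)"
    using d duA
    by (simp add: frechet_derivative_add frechet_derivative_bounded_bilinear[OF bounded_bilinear_inner] frechet_derivative_grad)
  finally have div_P: "divergence (\<lambda>y. (A t y \<bullet> W t y) *\<^sub>R u t y - (h t y + u t y \<bullet> A t y) *\<^sub>R W t y) x = \<dots>" .
  have "time_deriv W t x = - divergence (u t) x *\<^sub>R W t x
      - (frechet_derivative (W t) (at x) (u t x) - frechet_derivative (u t) (at x) (W t x))"
    using sym by (simp add: time_dependent_symmetry_def lie_bracket_def eq_diff_eq)
  moreover have "time_deriv A t x = u t x \<times> curl (A t) x + grad (h t) x"
    using A_eq[of t x] by (simp add: algebra_simps)
  \<comment> \<open>These two Jacobian terms of A cancel those in the divergence of the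
    flux.\<close>
  moreover have "(u t x \<times> curl (A t) x) \<bullet> W t x
      = u t x \<bullet> frechet_derivative (A t) (at x) (W t x) - frechet_derivative (A t) (at x) (u t x) \<bullet> W t x"
    by (rule cross_curl_inner) (rule d)
  ultimately have "time_deriv (\<lambda>t x. A t x \<bullet> W t x) t x
      = A t x \<bullet> (- divergence (u t) x *\<^sub>R W t x
          - (frechet_derivative (W t) (at x) (u t x) - frechet_derivative (u t) (at x) (W t x)))
        + (u t x \<bullet> frechet_derivative (A t) (at x) (W t x) - frechet_derivative (A t) (at x) (u t x) \<bullet> W t x
          + grad (h t) x \<bullet> W t x)"
    by (simp add: time_deriv_bounded_bilinear[OF bounded_bilinear_inner A W] inner_add_left)
  with div_P show ?thesis
    by (simp add: inner_simps inner_commute algebra_simps)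
qed


section \<open>Eulerian expressions\<close>

lemma eulerian_expression_cong:
  "(\<And>f. smooth_fields f \<Longrightarrow> T f = T' f) \<Longrightarrow> eulerian_expression T' \<Longrightarrow> eulerian_expression T"
  by (auto simp: eulerian_expression_def)

lemma differential_function_imp_eulerian: "differential_function e \<Longrightarrow> eulerian_expression e"
  by (auto simp: eulerian_expression_def)

text \<open>Rules 3 to 7 are those for the five fields.\<close>

lemmas eulerian_expression_fields = differential_function.intros(3-7)[THEN differential_function_imp_eulerian]

lemma eulerian_expression_comp:
  assumes "eulerian_expression T" "eulerian_expression T'" "smooth (g :: real \<times> real \<Rightarrow> real)"
  shows "eulerian_expression (\<lambda>f t x. g (T f t x, T' f t x))"
proof -
  from assms(1,2) obtain e e' where "differential_function e" "differential_function e'"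
    and "\<And>f. smooth_fields f \<Longrightarrow> T f = e f" "\<And>f. smooth_fields f \<Longrightarrow> T' f = e' f"
    unfolding eulerian_expression_def by blast
  with differential_function.comp[OF _ _ assms(3)] show ?thesis
    by (intro eulerian_expression_cong[OF _ differential_function_imp_eulerian, of _ "\<lambda>f t x. g (e f t x, e' f t x)"]) auto
qed

lemma eulerian_expression_add:
  "eulerian_expression T \<Longrightarrow> eulerian_expression T' \<Longrightarrow> eulerian_expression (\<lambda>f t x. T f t x + T' f t x)"
  using eulerian_expression_comp[OF _ _ smooth_linear[OF bounded_linear_add[OF bounded_linear_fst bounded_linear_snd]]]
  by simp

lemma eulerian_expression_diff:
  "eulerian_expression T \<Longrightarrow> eulerian_expression T' \<Longrightarrow> eulerian_expression (\<lambda>f t x. T f t x - T' f t x)"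
  using eulerian_expression_comp[OF _ _ smooth_linear[OF bounded_linear_sub[OF bounded_linear_fst bounded_linear_snd]]]
  by simp

lemma eulerian_expression_minus:
  "eulerian_expression T \<Longrightarrow> eulerian_expression (\<lambda>f t x. - T f t x)"
  \<comment> \<open>The composition rule is binary, so negation is applied to the first of two equal
    arguments.\<close>
  using eulerian_expression_comp[OF _ _ smooth_linear[OF bounded_linear_minus[OF bounded_linear_fst]], of T T]
  by simp

lemma eulerian_expression_mult:
  "eulerian_expression T \<Longrightarrow> eulerian_expression T' \<Longrightarrow> eulerian_expression (\<lambda>f t x. T f t x * T' f t x)"
  using eulerian_expression_comp[OF _ _ smooth_bounded_bilinear[OF bounded_bilinear_mult
      smooth_linear[OF bounded_linear_fst] smooth_linear[OF bounded_linear_snd]]]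
  by simp

text \<open>On smooth fields T and its expression agree as functions of t and x, so the agreement
  passes to derivatives.\<close>

lemma eulerian_expression_time_deriv:
  assumes "eulerian_expression T"
  shows "eulerian_expression (\<lambda>f. time_deriv (T f))"
proof -
  from assms obtain e where "differential_function e" "\<And>f. smooth_fields f \<Longrightarrow> T f = e f"
    unfolding eulerian_expression_def by blast
  with differential_function.time_deriv show ?thesis
    by (intro eulerian_expression_cong[OF _ differential_function_imp_eulerian, of _ "\<lambda>f. time_deriv (e f)"]) auto
qed

lemma eulerian_expression_partial:
  assumes "eulerian_expression T"
  shows "eulerian_expression (\<lambda>f t. partial i (T f t))"
proof -
  from assms obtain e where "differential_function e" "\<And>f. smooth_fields f \<Longrightarrow> T f = e f"
    unfolding eulerian_expression_def by blast
  with differential_function.partial show ?thesis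
    by (intro eulerian_expression_cong[OF _ differential_function_imp_eulerian, of _ "\<lambda>f t. partial i (e f t)"]) auto
qed

lemmas eulerian_expression_intros = eulerian_expression_fields eulerian_expression_add
  eulerian_expression_diff eulerian_expression_minus eulerian_expression_mult
  eulerian_expression_time_deriv eulerian_expression_partial

lemma eulerian_expression_cross:
  assumes "\<And>i. eulerian_expression (\<lambda>f t x. F f t x $ i)" "\<And>i. eulerian_expression (\<lambda>f t x. G f t x $ i)"
  shows "eulerian_expression (\<lambda>f t x. (F f t x \<times> G f t x) $ i)"
  using exhaust_3[of i] by (auto simp: cross3_def intro!: eulerian_expression_intros assms)

lemma eulerian_expression_curl:
  assumes "\<And>i. eulerian_expression (\<lambda>f t x. F f t x $ i)"
  shows "eulerian_expression (\<lambda>f t x. curl (F f t) x $ i)"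
  using exhaust_3[of i] by (auto simp: curl_def intro!: eulerian_expression_intros assms)

lemma eulerian_expression_inner:
  fixes F G :: "eulerian_fields \<Rightarrow> real \<Rightarrow> real^3 \<Rightarrow> real^3"
  assumes "\<And>i. eulerian_expression (\<lambda>f t x. F f t x $ i)" "\<And>i. eulerian_expression (\<lambda>f t x. G f t x $ i)"
  shows "eulerian_expression (\<lambda>f t x. F f t x \<bullet> G f t x)"
  by (auto simp: inner_vec_def sum_3 intro!: eulerian_expression_intros assms)

lemma eulerian_expression_electric: "eulerian_expression (\<lambda>f t x. electric f t x $ i)"
  by (auto simp: electric_def grad_def intro!: eulerian_expression_intros eulerian_expression_cross)

text \<open>The current contains the time derivative of a vector, whereas expressions are scalar.
  Passing to the derivative of a component needs differentiability of \<open>electric\<close>, which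
  the restriction to smooth fields provides.\<close>

lemma eulerian_expression_current: "eulerian_expression (\<lambda>f t x. current f t x $ i)"
proof (rule eulerian_expression_cong)
  show "(\<lambda>t x. current f t x $ i) = (\<lambda>t x. curl (mag f t) x $ i - time_deriv (\<lambda>t x. electric f t x $ i) t x)"
    if "smooth_fields f" for f
    by (simp add: current_eq time_deriv_nth[OF smooth_field_electric[OF that]])
  show "eulerian_expression (\<lambda>f t x. curl (mag f t) x $ i - time_deriv (\<lambda>t x. electric f t x $ i) t x)"
    by (intro eulerian_expression_intros eulerian_expression_curl eulerian_expression_electric)
qed

lemma eulerian_expression_relative_current: "eulerian_expression (\<lambda>f t x. relative_current f t x $ i)"
  by (auto simp: relative_current_def charge_def divergence_def sum_3
      intro!: eulerian_expression_intros eulerian_expression_electric eulerian_expression_current)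

text \<open>The flux is that of \<open>potential_symmetry_conservation\<close> with h the sum of
  \<open>phi\<close> and \<open>psi\<close>, one expression for all solutions. The invariance
  criterion supplies the two assumptions on the relative current.\<close>

lemma eulerian_conserved_density_relative_current:
  "eulerian_conserved_density {f. frozen_in_system f \<and> absolute_invariant 3 (vel f) (Theta_E f)}
    (\<lambda>f t x. pot f t x \<bullet> relative_current f t x)"
  unfolding eulerian_conserved_density_def
proof (intro conjI exI allI ballI)
  let ?T = "\<lambda>f t x. pot f t x \<bullet> relative_current f t x"
  let ?P = "\<lambda>f t x. ?T f t x *\<^sub>R vel f t x - ((phi f t x + psi f t x) + vel f t x \<bullet> pot f t x) *\<^sub>R relative_current f t x"
  show T: "eulerian_expression ?T"
    by (intro eulerian_expression_inner eulerian_expression_intros eulerian_expression_relative_current)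
  have h: "eulerian_expression (\<lambda>f t x. (phi f t x + psi f t x) + vel f t x \<bullet> pot f t x)"
    by (intro eulerian_expression_inner eulerian_expression_intros)
  show "eulerian_expression (\<lambda>f t x. ?P f t x $ i)" for i
    unfolding vector_minus_component vector_scaleR_component real_scaleR_def
    by (intro eulerian_expression_diff eulerian_expression_mult T h eulerian_expression_relative_current
        eulerian_expression_fields)
  fix f t x
  assume "f \<in> {f. frozen_in_system f \<and> absolute_invariant 3 (vel f) (Theta_E f)}"
  then have f: "smooth_fields f" and frozen: "frozen_in_system f"
    and "absolute_invariant 3 (vel f) (Theta_E f)"
    by (auto simp: frozen_in_system_def)
  then have "divergence_free (relative_current f)" "time_dependent_symmetry (vel f) (relative_current f)"
    by (simp_all add: absolute_invariant_Theta_E_iff)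
  then show "time_deriv (?T f) t x + divergence (?P f t) x = 0"
    using frozen
    by (intro potential_symmetry_conservation smooth_field_add smooth_field_relative_current smooth_fieldsD f)
      (auto simp: frozen_in_system_def)
qed


section \<open>Dependence on the dynamics of the velocity\<close>

text \<open>A uniform magnetic field along the third axis is frozen into every flow that is uniform in
  space. For the acceleration \<open>c\<close> along the first axis, \<open>q = 0\<close> and \<open>q u - J = \<partial>_t E = (0, c, 0)\<close>.\<close>

definition accelerated_flow :: "real \<Rightarrow> eulerian_fields" where
  "accelerated_flow c =
    \<lparr>vel = \<lambda>t x. (c * t) *\<^sub>R axis 1 1, pot = \<lambda>t x. (x $ 1) *\<^sub>R axis 2 1, mag = \<lambda>t x. axis 3 1,
      phi = \<lambda>t x. 0, psi = \<lambda>t x. c * t * x $ 2\<rparr>"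

lemma accelerated_flow_sel:
  "vel (accelerated_flow c) = (\<lambda>t x. (c * t) *\<^sub>R axis 1 1)"
  "pot (accelerated_flow c) = (\<lambda>t x. (x $ 1) *\<^sub>R axis 2 1)"
  "mag (accelerated_flow c) = (\<lambda>t x. axis 3 1)"
  "phi (accelerated_flow c) = (\<lambda>t x. 0)"
  "psi (accelerated_flow c) = (\<lambda>t x. c * t * x $ 2)"
  by (simp_all add: accelerated_flow_def)

lemma partial_nth_ident: "partial i (\<lambda>y. y $ j) x = axis i 1 $ j"
  by (simp add: partial_def frechet_derivative_bounded_linear[OF bounded_linear_vec_nth differentiable_ident])

lemma partial_cmult_nth_ident: "partial i (\<lambda>y. c * y $ j) x = c * axis i 1 $ j"
  using frechet_derivative_bounded_linear[OF bounded_linear_const_mult[OF bounded_linear_vec_nth] differentiable_ident]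
  by (simp add: partial_def)

lemma partial_const: "partial i (\<lambda>y. c) x = 0"
  by (simp add: partial_def)

lemma grad_const: "grad (\<lambda>y. c) x = 0"
  by (simp add: grad_def partial_const vec_eq_iff)

lemma curl_const: "curl (\<lambda>y. c) x = 0"
  by (simp add: curl_def partial_const vec_eq_iff forall_3)

lemma divergence_const: "divergence (\<lambda>y. c) x = 0"
  by (simp add: divergence_def partial_const)

lemma time_deriv_const: "time_deriv (\<lambda>t. F) t x = 0"
  by (simp add: time_deriv_def)

lemma curl_pot_accelerated_flow: "curl (pot (accelerated_flow c) t) x = axis 3 1"
  by (simp add: curl_def accelerated_flow_sel vec_eq_iff forall_3 axis_def[of 2 1] partial_nth_ident partial_const)
    (simp add: axis_def)

lemma frozen_in_system_accelerated_flow: "frozen_in_system (accelerated_flow c)"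
proof -
  have "smooth_fields (accelerated_flow c)"
    unfolding smooth_fields_def accelerated_flow_sel
    by (intro conjI smooth_field_scaleR smooth_field_mult smooth_field_const smooth_field_time
        smooth_field_nth smooth_field_space)
  \<comment> \<open>With e_i the basis vectors, the equation for the static potential requires grad
    psi = - u \<times> e_3 = c t e_2, which dictates the choice of psi.\<close>
  moreover have "grad (\<lambda>y. c * t * y $ 2) x = (c * t) *\<^sub>R axis 2 1" for t x
    by (simp add: grad_def partial_cmult_nth_ident vec_eq_iff) (simp add: axis_def)
  ultimately show ?thesis
    unfolding frozen_in_system_def curl_pot_accelerated_flow
    by (simp add: accelerated_flow_sel curl_const time_deriv_const cross_mult_left cross_basis grad_const)
qed

lemma relative_current_accelerated_flow: "relative_current (accelerated_flow c) = (\<lambda>t x. c *\<^sub>R axis 2 1)"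
proof -
  have E: "electric (accelerated_flow c) = (\<lambda>t x. (c * t) *\<^sub>R axis 2 1)"
    by (simp add: electric_def accelerated_flow_sel cross_mult_left cross_basis grad_const fun_eq_iff)
  have "((\<lambda>s. (c * s) *\<^sub>R axis 2 1) has_vector_derivative c *\<^sub>R axis 2 (1::real)) (at t)" for t
    by (auto intro!: derivative_eq_intros)
  then have "time_deriv (electric (accelerated_flow c)) t x = c *\<^sub>R axis 2 1" for t x
    unfolding E by (simp add: time_deriv_def vector_derivative_at)
  then show ?thesis
    unfolding relative_current_eq
    by (simp add: charge_def current_def E divergence_const fun_eq_iff) (simp add: accelerated_flow_sel curl_const)
qed

text \<open>The relative current is constant in time and space and the velocity is uniform in space,
  so every term of the criterion vanishes.\<close>

lemma absolute_invariant_accelerated_flow: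
  "absolute_invariant 3 (vel (accelerated_flow c)) (Theta_E (accelerated_flow c))"
proof -
  have "smooth_fields (accelerated_flow c)"
    using frozen_in_system_accelerated_flow by (simp add: frozen_in_system_def)
  from absolute_invariant_Theta_E_iff[OF this] show ?thesis
    by (simp add: relative_current_accelerated_flow divergence_free_def time_dependent_symmetry_def divergence_const
        time_deriv_const lie_bracket_def accelerated_flow_sel)
qed

theorem proposition3:
  fixes S :: "eulerian_fields set" and T :: "eulerian_fields \<Rightarrow> real \<Rightarrow> real^3 \<Rightarrow> real"
  assumes "S = {f. frozen_in_system f \<and> absolute_invariant 3 (vel f) (Theta_E f)}"
    and "T = (\<lambda>f t x. pot f t x \<bullet> relative_current f t x)"
  shows "(\<forall>f. frozen_in_system f \<longrightarrow>
            (absolute_invariant 3 (vel f) (Theta_E f) \<longleftrightarrow>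
             divergence_free (relative_current f) \<and>
             time_dependent_symmetry (vel f) (relative_current f))) \<and>
         (\<forall>f\<in>S. divergence_free (vel f) \<longrightarrow> lagrangian_invariant (vel f) (charge f)) \<and>
         eulerian_conserved_density S T \<and>
         depends_on_velocity_dynamics S T"
proof (intro conjI allI impI ballI)
  show "absolute_invariant 3 (vel f) (Theta_E f) \<longleftrightarrow>
      divergence_free (relative_current f) \<and> time_dependent_symmetry (vel f) (relative_current f)"
    if "frozen_in_system f" for f
    using that by (intro absolute_invariant_Theta_E_iff) (simp add: frozen_in_system_def)
  show "lagrangian_invariant (vel f) (charge f)" if "f \<in> S" "divergence_free (vel f)" for f
    using that by (intro lagrangian_invariant_charge) (auto simp: assms(1) frozen_in_system_def)
  show "eulerian_conserved_density S T"
    unfolding assms by (rule eulerian_conserved_density_relative_current)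
  have "accelerated_flow c \<in> S" for c
    by (simp add: assms(1) frozen_in_system_accelerated_flow absolute_invariant_accelerated_flow)
  \<comment> \<open>At t = 0 velocity and psi vanish for every c, so the two solutions agree there;
    the density is c times the first coordinate and separates c = 0 from c = 1 at the first basis
    vector.\<close>
  moreover have "T (accelerated_flow 0) 0 (axis 1 1) \<noteq> T (accelerated_flow 1) 0 (axis 1 1)"
    by (simp add: assms(2) relative_current_accelerated_flow) (simp add: accelerated_flow_sel inner_axis_axis)
  ultimately show "depends_on_velocity_dynamics S T"
    unfolding depends_on_velocity_dynamics_def
    by (intro bexI[of _ "accelerated_flow 0"] bexI[of _ "accelerated_flow 1"] exI[of _ 0] exI[of _ "axis 1 1"])
      (simp_all add: accelerated_flow_sel)
qed

end
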